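(* Let $M=\mathbb H^3/\Gamma$ be a finite volume hyperbolic 3-manifold, let $A$ be the finite generating set of a given presentation of $\Gamma$, let $x\in\mathbb H^3$ be a basepoint, let $D$ be the Dirichlet domain of $\Gamma$ centered at $x$, and let $R>0$. Then there is $\epsilon>0$ such that for every approximate Dirichlet domain $D'$ of $\Gamma$ centered at $x$ (with respect to $A$): if $\Delta V=\operatorname{vol}(D')-\operatorname{vol}(D)<\epsilon$ and the basepoint $x$ minimizes the spine radius $r'$ of $D'$, then the Cayley graph $C'$ associated with $D'$ is connected inside the ball $B(x,R)$; that is, the subgraph of $C'$ induced on the vertex set $\{g\in\Gamma: gx\in B(x,R)\}$ is connected.
   Context: A hyperbolic 3-manifold is a quotient $M=\mathbb H^3/\Gamma$ with $\Gamma\subset PSL(2,\mathbb C)$ a subgroup acting freely and properly discontinuously on $\mathbb H^3$; $d$ is the hyperbolic distance, and $B(x,R)=\{y\in\mathbb H^3: d(x,y)<R\}$. For $g\in\Gamma\setminus\{1\}$ put $H_g=\{y\in\mathbb H^3: d(x,y)\le d(gx,y)\}$. The Dirichlet domain of $\Gamma$ centered at $x$ is $D=D_x(\Gamma)=\bigcap_{g\in\Gamma\setminus\{1\}}H_g$; since $M$ has finite volume, it is a finite sided convex polyhedron. An approximate Dirichlet domain $D'$ of $\Gamma$ centered at $x$ (with respect to $A$) is a polyhedron $D'=\bigcap_{g\in S}H_g$, where $S\subset\Gamma\setminus\{1\}$ is a finite set containing all generators $a\in A$ and their inverses, such that every generator and every inverse of a generator corresponds to a face of $D'$. It always contains $D$.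 An element $g\in\Gamma\setminus\{1\}$ corresponds to a (2-dimensional) face of $D'$ if $\partial H_g\cap D'$ is a 2-dimensional face of $D'$. The Cayley graph $C'$ associated with $D'$ is the Cayley graph of $\Gamma$ with vertex set $\Gamma$ and generating set the set of elements $s\in\Gamma$ corresponding to faces of $D'$, with an edge from $g$ to $gs$ for each $g\in\Gamma$ and each such $s$. Connectedness is in the sense of the underlying undirected graph. The spine radius of $D'$ is the maximum, over all edges $e$ of the polyhedron $D'$, of the minimal distance from $x$ to $e$. For $y\in\mathbb H^3$, let $D'_y=\bigcap_{g\in S}\{z: d(y,z)\le d(gy,z)\}$ be the polyhedron built from the same set $S$ with basepoint $y$, whose spine radius is measured from $y$. That $x$ minimizes the spine radius of $D'=D'_x$ means that the spine radius of $D'_x$ is at most that of $D'_y$ for all $y$ in some neighborhood of $x$. *)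

theory Defs
  imports
    "HOL-Analysis.Analysis"
    "HOL-Algebra.Coset"
    "HOL-Algebra.Generated_Groups"
    "Graph_Theory.Graph_Theory"
begin

section \<open>Hyperbolic 3-space\<close>

text \<open>
  We use the projective (Klein) model: hyperbolic space is the open unit ball of
  \<open>\<real>\<^sup>3\<close>, a point \<open>p\<close> of which stands for the ray through \<open>(1, p)\<close> in Minkowski space.
  In this model geodesic segments are Euclidean segments, and totally geodesic subspaces are
  the intersections of the ball with affine subspaces of the same dimension.  So hyperbolic
  convexity, faces and their dimensions are literally \<^const>\<open>convex\<close>, \<^const>\<open>face_of\<close> and
  \<^const>\<open>aff_dim\<close>.  The hyperbolic topology is the Euclidean one.
\<close>

definition H3 :: "(real^3) set" where
  "H3 = ball 0 1"

text \<open>Hyperbolic distance of curvature \<open>-1\<close>.\<close>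

definition hdist :: "real^3 \<Rightarrow> real^3 \<Rightarrow> real" where
  "hdist p q = arcosh ((1 - p \<bullet> q) / sqrt ((1 - p \<bullet> p) * (1 - q \<bullet> q)))"

definition hball :: "real^3 \<Rightarrow> real \<Rightarrow> (real^3) set" where
  "hball x R = {y \<in> H3. hdist x y < R}"

text \<open>
  The Riemannian volume.  The metric tensor of the Klein model at \<open>p\<close> has determinant
  \<open>(1 - p \<bullet> p) powr (- (n + 1))\<close> in dimension \<open>n\<close>; the density is its square root for \<open>n = 3\<close>.
\<close>

definition hvol :: "(real^3) measure" where
  "hvol = density lborel (\<lambda>p. ennreal (indicator H3 p / (1 - p \<bullet> p)\<^sup>2))"


section \<open>The group \<open>PSL(2,\<complex>)\<close> and its action\<close>

definition SL2C :: "(complex^2^2) monoid" where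
  "SL2C = \<lparr>carrier = {A. det A = 1}, mult = (**), one = mat 1\<rparr>"

definition PSL2C :: "(complex^2^2) set monoid" where
  "PSL2C = SL2C Mod {mat 1, - mat 1}"

text \<open>
  \<open>SL(2,\<complex>)\<close> acts on Minkowski space, realised as the Hermitian \<open>2 \<times> 2\<close> matrices
  \<open>X = t 1 + x \<sigma>\<^sub>1 + y \<sigma>\<^sub>2 + z \<sigma>\<^sub>3\<close> (Pauli matrices) with quadratic form
  \<open>det X = t\<^sup>2 - x\<^sup>2 - y\<^sup>2 - z\<^sup>2\<close>, by \<open>X \<mapsto> A X A\<^sup>*\<close>.  The point \<open>p\<close> of the Klein model is the ray
  of \<open>herm p\<close>, and \<open>klein_point X\<close> is \<open>(x, y, z) / t\<close>.
\<close>

definition herm :: "real^3 \<Rightarrow> complex^2^2" where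
  "herm p = vector [vector [complex_of_real (1 + p $ 3), Complex (p $ 1) (- p $ 2)],
                    vector [Complex (p $ 1) (p $ 2), complex_of_real (1 - p $ 3)]]"

definition klein_point :: "complex^2^2 \<Rightarrow> real^3" where
  "klein_point X = (1 / Re (trace X)) *\<^sub>R
     vector [2 * Re (X $ 2 $ 1), 2 * Im (X $ 2 $ 1), Re (X $ 1 $ 1 - X $ 2 $ 2)]"

definition conj_transpose :: "complex^2^2 \<Rightarrow> complex^2^2" where
  "conj_transpose A = (\<chi> i j. cnj (A $ j $ i))"

definition sl_act :: "complex^2^2 \<Rightarrow> real^3 \<Rightarrow> real^3" where
  "sl_act A p = klein_point (A ** herm p ** conj_transpose A)"

text \<open>An element of \<open>PSL(2,\<complex>)\<close> is a coset \<open>{A, -A}\<close>, and both representatives act alike.\<close>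

definition psl_act :: "(complex^2^2) set \<Rightarrow> real^3 \<Rightarrow> real^3" where
  "psl_act g p = sl_act (SOME A. A \<in> g) p"

text \<open>
  The definitions above do give an action of the group \<open>PSL(2,\<complex>)\<close> on \<open>H3\<close> by isometries:
  see \<open>group_PSL2C\<close>, \<open>psl_act_coset\<close>, \<open>psl_act_in_H3\<close>, \<open>psl_act_one\<close>, \<open>psl_act_mult\<close> and
  \<open>hdist_psl_act\<close>.
\<close>

lemma herm_nth [simp]:
  "herm p $ 1 $ 1 = complex_of_real (1 + p $ 3)" "herm p $ 1 $ 2 = Complex (p $ 1) (- p $ 2)"
  "herm p $ 2 $ 1 = Complex (p $ 1) (p $ 2)" "herm p $ 2 $ 2 = complex_of_real (1 - p $ 3)"
  by (simp_all add: herm_def)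

lemma conj_transpose_mult: "conj_transpose (A ** B) = conj_transpose B ** conj_transpose A"
  by (simp add: conj_transpose_def matrix_matrix_mult_def vec_eq_iff mult.commute)

lemma det_conj_transpose: "det (conj_transpose A) = cnj (det A)"
  by (simp add: det_2 conj_transpose_def mult.commute)

lemma scaleR_matrix_mult:
  fixes A B :: "complex^2^2"
  shows "A ** (c *\<^sub>R B) = c *\<^sub>R (A ** B)" "(c *\<^sub>R A) ** B = c *\<^sub>R (A ** B)"
  by (simp_all add: vec_eq_iff matrix_matrix_mult_def scaleR_sum_right)

lemma matrix_mult_add_right:
  fixes A B C :: "complex^2^2"
  shows "(A + B) ** C = A ** C + B ** C"
  by (simp add: vec_eq_iff matrix_matrix_mult_def sum.distrib distrib_right)

lemma sl_act_one: "sl_act (mat 1) p = p"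
proof -
  have "conj_transpose (mat 1) = mat 1"
    by (auto simp: conj_transpose_def mat_def vec_eq_iff)
  moreover have "klein_point (herm p) = p"
    by (simp add: klein_point_def trace_def sum_2 vec_eq_iff forall_3)
  ultimately show ?thesis
    by (simp add: sl_act_def)
qed

lemma sl_act_uminus: "sl_act (- A) p = sl_act A p"
proof -
  have "(- A) ** herm p ** conj_transpose (- A) = A ** herm p ** conj_transpose A"
    by (simp add: vec_eq_iff matrix_matrix_mult_def conj_transpose_def sum_2 algebra_simps)
  then show ?thesis
    by (simp add: sl_act_def)
qed

lemma conj_transpose_herm: "conj_transpose (herm p) = herm p"
  by (simp add: conj_transpose_def vec_eq_iff forall_2 complex_eq_iff)

lemma det_herm: "det (herm p) = complex_of_real (1 - p \<bullet> p)"
  by (simp add: det_2 inner_vec_def sum_3 complex_eq_iff algebra_simps power2_eq_square)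

lemma det_herm_add: "det (herm p + herm q) = det (herm p) + det (herm q) + complex_of_real (2 * (1 - p \<bullet> q))"
  by (simp add: det_2 inner_vec_def sum_3 complex_eq_iff algebra_simps power2_eq_square)

lemma herm_klein_point:
  assumes "conj_transpose X = X" and "Re (trace X) \<noteq> 0"
  shows "herm (klein_point X) = (2 / Re (trace X)) *\<^sub>R X"
proof -
  have *: "cnj (X $ j $ i) = X $ i $ j" for i j
    using assms(1) by (simp add: conj_transpose_def vec_eq_iff)
  define t where "t = Re (trace X)"
  have t: "t \<noteq> 0" "Re (X $ 2 $ 2) = t - Re (X $ 1 $ 1)"
    using assms(2) by (simp_all add: t_def trace_def sum_2)
  have im: "Im (X $ 1 $ 1) = 0" "Im (X $ 2 $ 2) = 0" "X $ 1 $ 2 = cnj (X $ 2 $ 1)"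
    using *[of 1 1] *[of 2 2] *[of 1 2] by (auto simp: complex_eq_iff)
  show ?thesis
    unfolding klein_point_def t_def[symmetric]
    using t(1) by (simp add: vec_eq_iff forall_2 complex_eq_iff t(2) im field_simps)
qed

lemma quadratic_form_pos:
  fixes u v n z :: real
  assumes "u \<noteq> 0 \<or> v \<noteq> 0" and "n\<^sup>2 + z\<^sup>2 < 1"
  shows "0 < u\<^sup>2 * (1 + z) + v\<^sup>2 * (1 - z) - 2 * (u * v * n)" (is "0 < ?Q")
proof -
  have "z\<^sup>2 < 1"
    using assms(2) zero_le_power2[of n] by linarith
  then have z: "0 < 1 + z"
    by (simp add: abs_square_less_1 abs_less_iff)
  have eq: "(1 + z) * ?Q = ((1 + z) * u - v * n)\<^sup>2 + v\<^sup>2 * (1 - (n\<^sup>2 + z\<^sup>2))"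
    by algebra
  have "0 < (1 + z) * ?Q"
  proof (cases "v = 0")
    case True
    then show ?thesis
      unfolding eq using assms(1) z by simp
  next
    case False
    then have "0 < v\<^sup>2 * (1 - (n\<^sup>2 + z\<^sup>2))"
      using assms(2) by simp
    then show ?thesis
      unfolding eq by (rule add_nonneg_pos[OF zero_le_power2])
  qed
  then show ?thesis
    using z by (simp only: zero_less_mult_pos)
qed

lemma trace_pos:
  assumes "det A = 1" "p \<in> H3"
  shows "Re (trace (A ** herm p ** conj_transpose A)) > 0"
proof -
  define w where "w = Complex (p $ 1) (- p $ 2)"
  have p: "(cmod w)\<^sup>2 + (p $ 3)\<^sup>2 < 1"
    using assms(2) by (simp add: w_def cmod_power2 H3_def norm_vec_def L2_set_def sum_3)
  define f where "f a b = (cmod a)\<^sup>2 * (1 + p $ 3) + (cmod b)\<^sup>2 * (1 - p $ 3) + 2 * Re (a * cnj b * w)"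
    for a b
  have row: "0 < f a b" if "a \<noteq> 0 \<or> b \<noteq> 0" for a b
  proof -
    have "\<bar>Re (a * cnj b * w)\<bar> \<le> cmod a * cmod b * cmod w"
      by (metis abs_Re_le_cmod complex_mod_cnj norm_mult)
    moreover have "0 < (cmod a)\<^sup>2 * (1 + p $ 3) + (cmod b)\<^sup>2 * (1 - p $ 3) - 2 * (cmod a * cmod b * cmod w)"
      using that p by (intro quadratic_form_pos) simp_all
    ultimately show ?thesis
      unfolding f_def abs_le_iff by linarith
  qed
  have entry: "Re ((A ** herm p ** conj_transpose A) $ i $ i) = f (A $ i $ 1) (A $ i $ 2)" for i
  proof -
    define a b where "a = A $ i $ 1" and "b = A $ i $ 2"
    have "herm p $ 1 $ 2 = w" "herm p $ 2 $ 1 = cnj w"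
      by (simp_all add: w_def complex_eq_iff)
    then have eq: "(A ** herm p ** conj_transpose A) $ i $ i =
        (a * cnj a) * complex_of_real (1 + p $ 3) + (b * cnj b) * complex_of_real (1 - p $ 3)
        + (a * cnj b * w + cnj (a * cnj b * w))"
      by (simp add: matrix_matrix_mult_def conj_transpose_def sum_2 algebra_simps
          del: herm_nth(2,3) flip: a_def b_def)
    show ?thesis
      unfolding eq a_def[symmetric] b_def[symmetric] f_def complex_norm_square[symmetric]
        of_real_mult[symmetric] by (simp add: algebra_simps)
  qed
  have "Re (trace (A ** herm p ** conj_transpose A)) = (\<Sum>i\<in>UNIV. f (A $ i $ 1) (A $ i $ 2))"
    by (simp only: trace_def Re_sum entry)
  moreover have "A $ i $ 1 \<noteq> 0 \<or> A $ i $ 2 \<noteq> 0" for i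
    using assms(1) exhaust_2[of i] by (auto simp: det_2)
  ultimately show ?thesis
    by (simp add: sum_pos row)
qed

lemma herm_sl_act:
  assumes "det A = 1" "p \<in> H3"
  obtains c where "c > 0" "herm (sl_act A p) = c *\<^sub>R (A ** herm p ** conj_transpose A)"
proof -
  have "conj_transpose (A ** herm p ** conj_transpose A) = A ** herm p ** conj_transpose A"
  proof -
    have "conj_transpose (conj_transpose A) = A" by (simp add: conj_transpose_def vec_eq_iff)
    then show ?thesis by (simp add: conj_transpose_mult conj_transpose_herm matrix_mul_assoc)
  qed
  then show ?thesis
    using trace_pos[OF assms] herm_klein_point[of "A ** herm p ** conj_transpose A"]
    by (intro that[of "2 / Re (trace (A ** herm p ** conj_transpose A))"]) (auto simp: sl_act_def)
qed

lemma det_scale: "det (c *\<^sub>R (X::complex^2^2)) = of_real (c^2) * det X"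
  by (simp add: det_2 algebra_simps power2_eq_square scaleR_conv_of_real[where 'a=complex])

lemma det_cong: "det A = 1 \<Longrightarrow> det (A ** X ** conj_transpose A) = det X"
  by (simp add: det_mul det_conj_transpose)

lemma inner_sl_act:
  assumes A: "det A = 1" and p: "p \<in> H3" and q: "q \<in> H3"
  obtains c d where "c > 0" "d > 0"
     "1 - sl_act A p \<bullet> sl_act A p = c^2 * (1 - p \<bullet> p)"
     "1 - sl_act A q \<bullet> sl_act A q = d^2 * (1 - q \<bullet> q)"
     "1 - sl_act A p \<bullet> sl_act A q = c * d * (1 - p \<bullet> q)"
proof -
  obtain c where c: "c > 0" "herm (sl_act A p) = c *\<^sub>R (A ** herm p ** conj_transpose A)"
    using herm_sl_act[OF A p] .
  obtain d where d: "d > 0" "herm (sl_act A q) = d *\<^sub>R (A ** herm q ** conj_transpose A)"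
    using herm_sl_act[OF A q] .
  have 1: "1 - sl_act A p \<bullet> sl_act A p = c^2 * (1 - p \<bullet> p)"
    using det_herm[of "sl_act A p"]
    unfolding c(2) det_scale det_cong[OF A] det_herm of_real_mult[symmetric] of_real_eq_iff by simp
  have 2: "1 - sl_act A q \<bullet> sl_act A q = d^2 * (1 - q \<bullet> q)"
    using det_herm[of "sl_act A q"]
    unfolding d(2) det_scale det_cong[OF A] det_herm of_real_mult[symmetric] of_real_eq_iff by simp
  have e: "c *\<^sub>R (A ** herm p ** conj_transpose A) + d *\<^sub>R (A ** herm q ** conj_transpose A)
     = A ** (c *\<^sub>R herm p + d *\<^sub>R herm q) ** conj_transpose A"
    by (simp add: scaleR_matrix_mult matrix_add_ldistrib matrix_mult_add_right)
  have f: "det (c *\<^sub>R herm p + d *\<^sub>R herm q) = of_real (c^2 * (1 - p\<bullet>p) + d^2 * (1 - q\<bullet>q) + 2*c*d*(1-p\<bullet>q))"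
    by (simp add: det_2 inner_vec_def sum_3 complex_eq_iff algebra_simps power2_eq_square)
  have "1 - sl_act A p \<bullet> sl_act A q = c * d * (1 - p \<bullet> q)"
    using det_herm_add[of "sl_act A p" "sl_act A q"]
    unfolding det_herm[of "sl_act A p"] det_herm[of "sl_act A q"] 1 2
    unfolding c(2) d(2) e det_cong[OF A] f of_real_add[symmetric] of_real_eq_iff by simp
  with 1 2 c(1) d(1) show ?thesis using that by blast
qed

lemma sl_act_in_H3: assumes "det A = 1" "p \<in> H3" shows "sl_act A p \<in> H3"
proof -
  obtain c d where "c > 0" "1 - sl_act A p \<bullet> sl_act A p = c^2 * (1 - p \<bullet> p)"
    using inner_sl_act[OF assms assms(2)] by metis
  moreover have "p \<bullet> p < 1" using assms(2) by (simp add: H3_def flip: power2_norm_eq_inner) (simp add: abs_square_less_1)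
  ultimately have "0 < 1 - sl_act A p \<bullet> sl_act A p"
    by (simp only:) (intro mult_pos_pos zero_less_power; simp)
  then show ?thesis by (simp add: H3_def flip: power2_norm_eq_inner) (simp add: abs_square_less_1)
qed

lemma hdist_sl_act:
  assumes "det A = 1" "p \<in> H3" "q \<in> H3" shows "hdist (sl_act A p) (sl_act A q) = hdist p q"
proof -
  obtain c d where *: "c > 0" "d > 0"
     "1 - sl_act A p \<bullet> sl_act A p = c^2 * (1 - p \<bullet> p)"
     "1 - sl_act A q \<bullet> sl_act A q = d^2 * (1 - q \<bullet> q)"
     "1 - sl_act A p \<bullet> sl_act A q = c * d * (1 - p \<bullet> q)"
    using inner_sl_act[OF assms] .
  have "c \<noteq> 0" "d \<noteq> 0"
    using *(1,2) by auto
  then show ?thesis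
    using *(1,2) by (simp add: hdist_def *(3-5) real_sqrt_mult)
qed

lemma klein_scale: "c > 0 \<Longrightarrow> klein_point (c *\<^sub>R X) = klein_point X"
  by (simp add: klein_point_def trace_def sum_2 vec_eq_iff forall_3 flip: distrib_left right_diff_distrib)

lemma sl_act_mult:
  assumes "det B = 1" "p \<in> H3"
  shows "sl_act (A ** B) p = sl_act A (sl_act B p)"
proof -
  obtain c where c: "c > 0" "herm (sl_act B p) = c *\<^sub>R (B ** herm p ** conj_transpose B)"
    using herm_sl_act[OF assms] .
  have "A ** (c *\<^sub>R (B ** herm p ** conj_transpose B)) ** conj_transpose A = c *\<^sub>R ((A ** B) ** herm p ** conj_transpose (A ** B))"
    by (simp add: scaleR_matrix_mult conj_transpose_mult matrix_mul_assoc)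
  then show ?thesis unfolding sl_act_def[of A] c(2) by (simp add: klein_scale c(1) sl_act_def)
qed

lemma group_SL2C: "group SL2C"
proof (rule groupI)
  fix A assume "A \<in> carrier SL2C"
  then have "det A = 1" by (simp add: SL2C_def)
  then obtain B where B: "B ** A = mat 1"
    by (metis invertible_det_nz invertible_def zero_neq_one)
  then have "det B = 1"
    using \<open>det A = 1\<close> by (metis det_I det_mul mult.right_neutral)
  with B show "\<exists>B \<in> carrier SL2C. B \<otimes>\<^bsub>SL2C\<^esub> A = \<one>\<^bsub>SL2C\<^esub>"
    by (auto simp: SL2C_def)
qed (auto simp: SL2C_def det_mul matrix_mul_assoc)

lemma uminus_mat_mult:
  fixes A B :: "complex^2^2"
  shows "(- A) ** B = - (A ** B)" "A ** (- B) = - (A ** B)"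
  by (simp_all add: vec_eq_iff matrix_matrix_mult_def sum_negf)

lemma det_uminus_2: "det (- A) = det (A :: complex^2^2)"
  by (simp add: det_2)

lemma center_normal_SL2C: "{mat 1, - mat 1} \<lhd> SL2C"
proof -
  interpret group SL2C by (rule group_SL2C)
  have car: "{mat 1, - mat 1} \<subseteq> carrier SL2C"
    by (auto simp: SL2C_def det_uminus_2)
  have "inv\<^bsub>SL2C\<^esub> (- mat 1) = - mat 1"
    by (rule inv_equality) (auto simp: SL2C_def det_uminus_2 uminus_mat_mult)
  moreover have "inv\<^bsub>SL2C\<^esub> (mat 1) = mat 1"
    by (rule inv_equality) (auto simp: SL2C_def)
  ultimately have "subgroup {mat 1, - mat 1} SL2C"
    using car by (intro subgroup.intro) (auto simp: SL2C_def uminus_mat_mult)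
  then show ?thesis
    by (rule normalI) (auto simp: r_coset_def l_coset_def SL2C_def uminus_mat_mult)
qed

lemma group_PSL2C: "group PSL2C"
  unfolding PSL2C_def by (rule normal.factorgroup_is_group[OF center_normal_SL2C])

lemma carrier_PSL2C: "carrier PSL2C = {{A, - A} | A. det A = 1}"
  by (auto simp: PSL2C_def FactGroup_def RCOSETS_def r_coset_def SL2C_def uminus_mat_mult)

lemma one_PSL2C: "\<one>\<^bsub>PSL2C\<^esub> = {mat 1, - mat 1}"
  by (simp add: PSL2C_def FactGroup_def)

lemma mult_PSL2C: "{A, - A} \<otimes>\<^bsub>PSL2C\<^esub> {B, - B} = {A ** B, - (A ** B)}"
  by (auto simp: PSL2C_def FactGroup_def set_mult_def SL2C_def uminus_mat_mult)

lemma psl_act_coset: "psl_act {A, - A} p = sl_act A p"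
proof -
  define B where "B = (SOME B. B \<in> {A, - A})"
  have "B \<in> {A, - A}"
    unfolding B_def by (rule someI[of _ A]) simp
  then have "B = A \<or> B = - A"
    by blast
  then have "sl_act B p = sl_act A p"
    using sl_act_uminus by metis
  then show ?thesis
    by (simp only: psl_act_def B_def)
qed

lemma psl_act_in_H3: "g \<in> carrier PSL2C \<Longrightarrow> p \<in> H3 \<Longrightarrow> psl_act g p \<in> H3"
  by (auto simp: carrier_PSL2C psl_act_coset sl_act_in_H3)

lemma psl_act_one: "psl_act \<one>\<^bsub>PSL2C\<^esub> p = p"
  by (simp add: one_PSL2C psl_act_coset sl_act_one)

lemma psl_act_mult:
  assumes "g \<in> carrier PSL2C" "h \<in> carrier PSL2C" "p \<in> H3"
  shows "psl_act (g \<otimes>\<^bsub>PSL2C\<^esub> h) p = psl_act g (psl_act h p)"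
  using assms by (auto simp: carrier_PSL2C mult_PSL2C psl_act_coset sl_act_mult)

lemma hdist_psl_act:
  assumes "g \<in> carrier PSL2C" "p \<in> H3" "q \<in> H3"
  shows "hdist (psl_act g p) (psl_act g q) = hdist p q"
  using assms by (auto simp: carrier_PSL2C psl_act_coset hdist_sl_act)


section \<open>Hyperbolic 3-manifolds of finite volume\<close>

definition acts_freely :: "(complex^2^2) set set \<Rightarrow> bool" where
  "acts_freely \<Gamma> \<longleftrightarrow> (\<forall>g \<in> \<Gamma> - {\<one>\<^bsub>PSL2C\<^esub>}. \<forall>p \<in> H3. psl_act g p \<noteq> p)"

definition acts_properly_discontinuously :: "(complex^2^2) set set \<Rightarrow> bool" where
  "acts_properly_discontinuously \<Gamma> \<longleftrightarrow>
     (\<forall>K. compact K \<and> K \<subseteq> H3 \<longrightarrow> finite {g \<in> \<Gamma>. psl_act g ` K \<inter> K \<noteq> {}})"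

definition covering_map :: "(complex^2^2) set set \<Rightarrow> real^3 \<Rightarrow> (real^3) set" where
  "covering_map \<Gamma> p = (\<lambda>g. psl_act g p) ` \<Gamma>"

definition quotient_manifold :: "(complex^2^2) set set \<Rightarrow> (real^3) set set" where
  "quotient_manifold \<Gamma> = covering_map \<Gamma> ` H3"

text \<open>
  The hyperbolic volume on the quotient is the Borel measure for which the covering map, a local
  isometry, preserves the volume of every Borel set on which it is injective.  A set of orbits is
  Borel if and only if its preimage, the union of these orbits, is Borel.
\<close>

definition is_quotient_volume :: "(complex^2^2) set set \<Rightarrow> (real^3) set measure \<Rightarrow> bool" where
  "is_quotient_volume \<Gamma> \<mu> \<longleftrightarrow>
     space \<mu> = quotient_manifold \<Gamma> \<and>
     sets \<mu> = {E. E \<subseteq> quotient_manifold \<Gamma> \<and> \<Union>E \<in> sets borel} \<and>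
     (\<forall>U \<in> sets borel. U \<subseteq> H3 \<and> inj_on (covering_map \<Gamma>) U \<longrightarrow>
        emeasure \<mu> (covering_map \<Gamma> ` U) = emeasure hvol U)"

definition finite_volume :: "(complex^2^2) set set \<Rightarrow> bool" where
  "finite_volume \<Gamma> \<longleftrightarrow>
     (\<exists>\<mu>. is_quotient_volume \<Gamma> \<mu> \<and> emeasure \<mu> (quotient_manifold \<Gamma>) < \<infinity>)"

definition finite_volume_hyperbolic_3_manifold :: "(complex^2^2) set set \<Rightarrow> bool" where
  "finite_volume_hyperbolic_3_manifold \<Gamma> \<longleftrightarrow>
     subgroup \<Gamma> PSL2C \<and> acts_freely \<Gamma> \<and> acts_properly_discontinuously \<Gamma> \<and> finite_volume \<Gamma>"


section \<open>Dirichlet domains and their approximations\<close>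

definition halfspace :: "real^3 \<Rightarrow> (complex^2^2) set \<Rightarrow> (real^3) set" where
  "halfspace x g = {y \<in> H3. hdist x y \<le> hdist (psl_act g x) y}"

definition domain_of :: "(complex^2^2) set set \<Rightarrow> real^3 \<Rightarrow> (real^3) set" where
  "domain_of S x = H3 \<inter> (\<Inter>g \<in> S. halfspace x g)"

definition dirichlet_domain :: "(complex^2^2) set set \<Rightarrow> real^3 \<Rightarrow> (real^3) set" where
  "dirichlet_domain \<Gamma> x = domain_of (\<Gamma> - {\<one>\<^bsub>PSL2C\<^esub>}) x"

text \<open>
  The frontier is taken in \<open>\<real>\<^sup>3\<close>; inside \<open>H3\<close>, which is open and contains \<open>D'\<close>, it agrees with
  the boundary of the half-space in hyperbolic space.
\<close>

definition corresponds_to_face ::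
    "real^3 \<Rightarrow> (real^3) set \<Rightarrow> (complex^2^2) set \<Rightarrow> bool" where
  "corresponds_to_face x D' g \<longleftrightarrow>
     (frontier (halfspace x g) \<inter> D') face_of D' \<and>
     aff_dim (frontier (halfspace x g) \<inter> D') = 2"

text \<open>
  An approximate Dirichlet domain is given by its defining set \<open>S\<close>, on which the polyhedra with
  moved basepoint depend; the polyhedron itself is \<open>domain_of S x\<close>.
\<close>

definition approx_dirichlet_domain ::
    "(complex^2^2) set set \<Rightarrow> (complex^2^2) set set \<Rightarrow> real^3 \<Rightarrow> (complex^2^2) set set \<Rightarrow> bool" where
  "approx_dirichlet_domain \<Gamma> A x S \<longleftrightarrow>
     finite S \<and> S \<subseteq> \<Gamma> - {\<one>\<^bsub>PSL2C\<^esub>} \<and>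
     (\<forall>a \<in> A. a \<in> S \<and> inv\<^bsub>PSL2C\<^esub> a \<in> S) \<and>
     (\<forall>a \<in> A. corresponds_to_face x (domain_of S x) a \<and>
              corresponds_to_face x (domain_of S x) (inv\<^bsub>PSL2C\<^esub> a))"

definition spine_radius :: "(complex^2^2) set set \<Rightarrow> real^3 \<Rightarrow> real" where
  "spine_radius S y = Max ((\<lambda>e. INF z \<in> e. hdist y z) ` {e. e edge_of domain_of S y})"

definition minimizes_spine_radius :: "(complex^2^2) set set \<Rightarrow> real^3 \<Rightarrow> bool" where
  "minimizes_spine_radius S x \<longleftrightarrow>
     (\<forall>\<^sub>F y in nhds x. spine_radius S x \<le> spine_radius S y)"


section \<open>The Cayley graph\<close>

definition cayley_graph ::
    "(complex^2^2) set set \<Rightarrow> real^3 \<Rightarrow> (real^3) set \<Rightarrow> (complex^2^2) set pair_pre_digraph" where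
  "cayley_graph \<Gamma> x D' =
     \<lparr>pverts = \<Gamma>,
      parcs = {(g, g \<otimes>\<^bsub>PSL2C\<^esub> s) | g s.
                 g \<in> \<Gamma> \<and> s \<in> \<Gamma> - {\<one>\<^bsub>PSL2C\<^esub>} \<and> corresponds_to_face x D' s}\<rparr>"

text \<open>\<^const>\<open>Digraph_Component.connected\<close> refers to the underlying undirected graph.\<close>

definition connected_inside_ball ::
    "(complex^2^2) set set \<Rightarrow> real^3 \<Rightarrow> (real^3) set \<Rightarrow> real \<Rightarrow> bool" where
  "connected_inside_ball \<Gamma> x D' R \<longleftrightarrow>
     Digraph_Component.connected
       (with_proj (cayley_graph \<Gamma> x D') \<restriction> {g \<in> \<Gamma>. psl_act g x \<in> hball x R})"

end

theory Submission
  imports Defs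
begin

text \<open>
  Let \<open>h \<noteq> 1\<close> with \<open>hx \<in> B(x, R)\<close>.  An approximate domain \<open>D'\<close> containing \<open>hx\<close> also
  contains, by convexity, the hull of \<open>hx\<close> and a fixed ball about \<open>x\<close> inside \<open>D\<close>; the part of
  this hull beyond the bisector of \<open>x\<close> and \<open>hx\<close> has positive volume, independent of \<open>D'\<close>, and
  lies outside \<open>D\<close>.  There are finitely many such \<open>h\<close>, so a small volume excess keeps all these
  orbit points out of \<open>D'\<close>.  Given \<open>g \<noteq> 1\<close> with \<open>gx \<in> B(x, R)\<close>, the point \<open>g\<^sup>-\<^sup>1 x\<close> then
  violates the half-space of some face \<open>s\<close>, that is, \<open>d(x, gsx) < d(x, gx)\<close>; iterating, one
  descends along edges of \<open>C'\<close> to the identity.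
\<close>

section \<open>Hyperbolic distance in the Klein model\<close>

text \<open>The Minkowski product of the unit vectors on the rays through \<open>(1, p)\<close> and
  \<open>(1, q)\<close>, that is, \<open>cosh\<close> of the hyperbolic distance. The root is split
  into two factors so that the one belonging to a single point can be cleared.\<close>

definition hcosh :: "real^3 \<Rightarrow> real^3 \<Rightarrow> real" where
  "hcosh p q = (1 - p \<bullet> q) / (sqrt (1 - p \<bullet> p) * sqrt (1 - q \<bullet> q))"

lemma H3_iff: "p \<in> H3 \<longleftrightarrow> p \<bullet> p < 1"
  by (simp add: H3_def norm_eq_sqrt_inner)

lemma H3_inner_less_one:
  assumes "p \<in> H3" "q \<in> H3"
  shows "p \<bullet> q < 1"
proof -
  have "0 \<le> (p - q) \<bullet> (p - q)"
    by simp
  then have "2 * (p \<bullet> q) \<le> p \<bullet> p + q \<bullet> q"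
    by (simp add: inner_diff_left inner_diff_right inner_commute)
  with assms show ?thesis
    by (simp add: H3_iff)
qed

lemma hcosh_pos: "p \<in> H3 \<Longrightarrow> q \<in> H3 \<Longrightarrow> 0 < hcosh p q"
  using H3_inner_less_one[of p q] by (simp add: hcosh_def H3_iff)

text \<open>
  The numerator of \<open>(hcosh p q)\<^sup>2 - 1\<close> is \<open>(dist p q)\<^sup>2\<close> minus the Gram determinant of \<open>p\<close> and
  \<open>q\<close>, which is also that of \<open>p - q\<close> and \<open>q\<close> and hence at most \<open>(dist p q)\<^sup>2 * (q \<bullet> q)\<close>.
\<close>

lemma hcosh_lower_bound:
  assumes p: "p \<in> H3" and q: "q \<in> H3"
  shows "1 + (dist p q)\<^sup>2 \<le> (hcosh p q)\<^sup>2"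
proof -
  have P: "0 < 1 - p \<bullet> p" "1 - p \<bullet> p \<le> 1" and Q: "0 < 1 - q \<bullet> q"
    using p q by (auto simp: H3_iff)
  have "0 \<le> ((p - q) \<bullet> q)\<^sup>2"
    by simp
  then have "(p \<bullet> q)\<^sup>2 \<ge> (p \<bullet> p) * (q \<bullet> q) - ((p - q) \<bullet> (p - q)) * (q \<bullet> q)"
    by (simp add: inner_diff_left inner_diff_right inner_commute algebra_simps power2_eq_square)
  then have "(1 - p \<bullet> q)\<^sup>2 \<ge> (1 - p \<bullet> p) * (1 - q \<bullet> q) + ((p - q) \<bullet> (p - q)) * (1 - q \<bullet> q)"
    by (simp add: inner_diff_left inner_diff_right inner_commute algebra_simps power2_eq_square)
  \<comment> \<open>The factor \<open>1 - p \<bullet> p\<close> is at most 1; inserting it produces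
    the denominator of \<open>(hcosh p q)\<^sup>2\<close>.\<close>
  moreover have "((p - q) \<bullet> (p - q)) * (1 - q \<bullet> q)
      \<ge> ((p - q) \<bullet> (p - q)) * ((1 - p \<bullet> p) * (1 - q \<bullet> q))"
    using P Q by (intro mult_left_mono) (auto simp: mult_le_cancel_right1)
  ultimately have "(1 + (p - q) \<bullet> (p - q)) * ((1 - p \<bullet> p) * (1 - q \<bullet> q)) \<le> (1 - p \<bullet> q)\<^sup>2"
    by (simp add: distrib_right)
  moreover have "(hcosh p q)\<^sup>2 = (1 - p \<bullet> q)\<^sup>2 / ((1 - p \<bullet> p) * (1 - q \<bullet> q))"
    using P Q by (simp add: hcosh_def power_divide power_mult_distrib)
  moreover have "(dist p q)\<^sup>2 = (p - q) \<bullet> (p - q)"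
    by (simp add: dist_norm power2_norm_eq_inner)
  ultimately show ?thesis
    using P Q by (simp add: le_divide_eq)
qed

lemma hcosh_ge_one:
  assumes "p \<in> H3" "q \<in> H3"
  shows "1 \<le> hcosh p q"
proof -
  have "1\<^sup>2 \<le> (hcosh p q)\<^sup>2"
    using hcosh_lower_bound[OF assms] zero_le_power2[of "dist p q"] unfolding one_power2 by linarith
  then show ?thesis
    using hcosh_pos[OF assms] by (meson power2_le_imp_le less_imp_le)
qed

lemma hcosh_gt_one:
  assumes "p \<in> H3" "q \<in> H3" "p \<noteq> q"
  shows "1 < hcosh p q"
proof -
  have "hcosh p q \<noteq> 1"
    using hcosh_lower_bound[OF assms(1,2)] assms(3) by (auto simp: not_le)
  with hcosh_ge_one[OF assms(1,2)] show ?thesis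
    by simp
qed

lemma hcosh_self: "p \<in> H3 \<Longrightarrow> hcosh p p = 1"
  by (simp add: hcosh_def H3_iff)

lemma hdist_eq_arcosh: "hdist p q = arcosh (hcosh p q)"
  by (simp add: hdist_def hcosh_def real_sqrt_mult)

lemma hdist_commute: "hdist p q = hdist q p"
  by (simp add: hdist_def inner_commute mult.commute)

lemma hdist_self: "p \<in> H3 \<Longrightarrow> hdist p p = 0"
  by (simp add: hdist_eq_arcosh hcosh_self)

lemma hdist_less_iff:
  "p \<in> H3 \<Longrightarrow> q \<in> H3 \<Longrightarrow> r \<in> H3 \<Longrightarrow> s \<in> H3 \<Longrightarrow> hdist p q < hdist r s \<longleftrightarrow> hcosh p q < hcosh r s"
  by (simp add: hdist_eq_arcosh hcosh_ge_one)

lemma hdist_le_iff: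
  "p \<in> H3 \<Longrightarrow> q \<in> H3 \<Longrightarrow> r \<in> H3 \<Longrightarrow> s \<in> H3 \<Longrightarrow> hdist p q \<le> hdist r s \<longleftrightarrow> hcosh p q \<le> hcosh r s"
  by (metis hdist_less_iff not_le)

text \<open>A bound on the distance from \<open>x\<close> keeps points away from the unit sphere, so
  the ball fits into a compact set to which proper discontinuity applies.\<close>

lemma hball_subset_cball:
  assumes x: "x \<in> H3"
  obtains K where "compact K" "K \<subseteq> H3" "hball x R \<subseteq> K"
proof -
  \<comment> \<open>A lower bound for \<open>sqrt (1 - z \<bullet> z)\<close>: solve \<open>1 - norm
    x \<le> 1 - x \<bullet> z \<le> cosh R * sqrt (1 - z \<bullet> z)\<close> for the root.\<close>
  define c where "c = (1 - norm x) / cosh R"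
  have nx: "norm x < 1"
    using x by (simp add: H3_def)
  have c0: "0 < c"
    using nx cosh_real_pos[of R] by (simp add: c_def)
  have sub: "z \<bullet> z \<le> 1 - c\<^sup>2" if z: "z \<in> H3" and d: "hdist x z < R" for z
  proof -
    have Z: "0 < sqrt (1 - z \<bullet> z)" and X: "0 < sqrt (1 - x \<bullet> x)" "sqrt (1 - x \<bullet> x) \<le> 1"
      using z x by (auto simp: H3_iff)
    have "0 \<le> hdist x z"
      using hcosh_ge_one[OF x z] by (simp add: hdist_eq_arcosh)
    then have "cosh (hdist x z) \<le> cosh R"
      using d by (simp add: cosh_real_nonneg_le_iff)
    then have le: "hcosh x z \<le> cosh R"
      using hcosh_ge_one[OF x z] by (simp add: hdist_eq_arcosh)
    have "x \<bullet> z \<le> norm x * norm z"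
      by (rule norm_cauchy_schwarz)
    also have "\<dots> \<le> norm x * 1"
      using z by (intro mult_left_mono) (auto simp: H3_def)
    finally have "1 - norm x \<le> 1 - x \<bullet> z"
      by simp
    also have "\<dots> = hcosh x z * (sqrt (1 - x \<bullet> x) * sqrt (1 - z \<bullet> z))"
      using X(1) Z by (simp add: hcosh_def)
    also have "\<dots> \<le> cosh R * (1 * sqrt (1 - z \<bullet> z))"
      using le X Z by (intro mult_mono) auto
    finally have "c \<le> sqrt (1 - z \<bullet> z)"
      using cosh_real_pos[of R] by (simp add: c_def divide_le_eq mult.commute)
    then have "c\<^sup>2 \<le> (sqrt (1 - z \<bullet> z))\<^sup>2"
      using c0 by (intro power_mono) auto
    then show ?thesis
      using Z by simp
  qed
  show ?thesis
  proof
    show "compact (cball 0 (sqrt (1 - c\<^sup>2)) :: (real^3) set)"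
      by simp
    show "cball 0 (sqrt (1 - c\<^sup>2)) \<subseteq> H3"
    proof
      fix z :: "real^3"
      assume "z \<in> cball 0 (sqrt (1 - c\<^sup>2))"
      then have "z \<bullet> z \<le> 1 - c\<^sup>2"
        by (simp add: norm_eq_sqrt_inner)
      moreover have "0 < c\<^sup>2"
        using c0 by simp
      ultimately show "z \<in> H3"
        unfolding H3_iff by linarith
    qed
    show "hball x R \<subseteq> cball 0 (sqrt (1 - c\<^sup>2))"
      using sub by (auto simp: hball_def norm_eq_sqrt_inner)
  qed
qed


section \<open>Half-spaces are linear\<close>

text \<open>Space part of the difference of the unit Minkowski vectors over \<open>z\<close> and
  \<open>x\<close>; \<open>bisector_offset\<close> is its time part. The points equidistant from
  \<open>x\<close> and \<open>z\<close> are Minkowski-orthogonal to this difference.\<close>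

definition bisector_normal :: "real^3 \<Rightarrow> real^3 \<Rightarrow> real^3" where
  "bisector_normal x z = z /\<^sub>R sqrt (1 - z \<bullet> z) - x /\<^sub>R sqrt (1 - x \<bullet> x)"

definition bisector_offset :: "real^3 \<Rightarrow> real^3 \<Rightarrow> real" where
  "bisector_offset x z = 1 / sqrt (1 - z \<bullet> z) - 1 / sqrt (1 - x \<bullet> x)"

text \<open>Each \<open>hcosh p y\<close> is affine in \<open>y\<close> up to the factor
  \<open>1 / sqrt (1 - y \<bullet> y)\<close>, which does not depend on \<open>p\<close>.\<close>

lemma hcosh_diff_bisector:
  assumes "y \<in> H3"
  shows "(hcosh z y - hcosh x y) * sqrt (1 - y \<bullet> y) = bisector_offset x z - bisector_normal x z \<bullet> y"
proof -
  have "hcosh p y * sqrt (1 - y \<bullet> y) = 1 / sqrt (1 - p \<bullet> p) - (p /\<^sub>R sqrt (1 - p \<bullet> p)) \<bullet> y" for p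
  proof -
    have "hcosh p y * sqrt (1 - y \<bullet> y) = (1 - p \<bullet> y) / sqrt (1 - p \<bullet> p)"
      using assms by (simp add: H3_iff hcosh_def)
    then show ?thesis
      by (simp add: divide_inverse algebra_simps)
  qed
  then show ?thesis
    by (simp add: bisector_offset_def bisector_normal_def inner_diff_left left_diff_distrib)
qed

lemma hcosh_bisector_iff:
  assumes "y \<in> H3"
  shows hcosh_le_iff_bisector:
      "hcosh x y \<le> hcosh z y \<longleftrightarrow> bisector_normal x z \<bullet> y \<le> bisector_offset x z"
    and hcosh_less_iff_bisector:
      "hcosh x y < hcosh z y \<longleftrightarrow> bisector_normal x z \<bullet> y < bisector_offset x z"
proof -
  have "0 < sqrt (1 - y \<bullet> y)"
    using assms by (simp add: H3_iff)
  then have "0 \<le> (hcosh z y - hcosh x y) * sqrt (1 - y \<bullet> y) \<longleftrightarrow> hcosh x y \<le> hcosh z y"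
    "0 < (hcosh z y - hcosh x y) * sqrt (1 - y \<bullet> y) \<longleftrightarrow> hcosh x y < hcosh z y"
    by (auto simp: zero_le_mult_iff zero_less_mult_iff)
  then show "hcosh x y \<le> hcosh z y \<longleftrightarrow> bisector_normal x z \<bullet> y \<le> bisector_offset x z"
    and "hcosh x y < hcosh z y \<longleftrightarrow> bisector_normal x z \<bullet> y < bisector_offset x z"
    unfolding hcosh_diff_bisector[OF assms] by auto
qed

text \<open>A unit Minkowski vector with positive time part is determined by its space part, so
  equal space parts force \<open>z = x\<close>.\<close>

lemma bisector_normal_nonzero:
  assumes "x \<in> H3" "z \<in> H3" "z \<noteq> x"
  shows "bisector_normal x z \<noteq> 0"
proof
  assume 0: "bisector_normal x z = 0"
  have X: "0 < 1 - x \<bullet> x" and Z: "0 < 1 - z \<bullet> z"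
    using assms by (auto simp: H3_iff)
  define u v where "u = inverse (sqrt (1 - x \<bullet> x))" and "v = inverse (sqrt (1 - z \<bullet> z))"
  have uv: "0 < u" "0 < v" "u\<^sup>2 * (1 - x \<bullet> x) = 1" "v\<^sup>2 * (1 - z \<bullet> z) = 1"
    using X Z by (auto simp: u_def v_def power_inverse)
  have eq: "v *\<^sub>R z = u *\<^sub>R x"
    using 0 by (simp add: bisector_normal_def u_def v_def)
  then have "(v *\<^sub>R z) \<bullet> (v *\<^sub>R z) = (u *\<^sub>R x) \<bullet> (u *\<^sub>R x)"
    by simp
  then have "v\<^sup>2 * (z \<bullet> z) = u\<^sup>2 * (x \<bullet> x)"
    by (simp add: power2_eq_square mult.assoc)
  with uv have "v\<^sup>2 = u\<^sup>2"
    by (simp add: algebra_simps)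
  with uv have "v = u"
    by (simp add: power2_eq_iff_nonneg less_imp_le)
  with eq uv assms(3) show False
    by simp
qed

lemma halfspace_eq:
  assumes "x \<in> H3" "psl_act g x \<in> H3"
  shows "halfspace x g =
    H3 \<inter> {y. bisector_normal x (psl_act g x) \<bullet> y \<le> bisector_offset x (psl_act g x)}"
  using assms by (auto simp: halfspace_def hdist_le_iff hcosh_le_iff_bisector)

lemma open_H3: "open H3" and convex_H3: "convex H3"
  by (simp_all add: H3_def)

text \<open>Frontiers are local. This discards the part of the unit sphere in the frontier of a
  half-space of \<open>H3\<close>.\<close>

lemma frontier_Int_open:
  assumes "open U"
  shows "frontier (U \<inter> C) \<inter> U = frontier C \<inter> U"
  using open_Int_closure_subset[OF assms, of C] closure_mono[of "U \<inter> C" C]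
  by (auto simp: frontier_def interior_open[OF assms])

lemma frontier_halfspace_Int:
  assumes "x \<in> H3" "psl_act g x \<in> H3" "psl_act g x \<noteq> x" "D \<subseteq> H3"
  shows "frontier (halfspace x g) \<inter> D =
    D \<inter> {y. bisector_normal x (psl_act g x) \<bullet> y = bisector_offset x (psl_act g x)}"
proof -
  have "frontier (halfspace x g) \<inter> H3 =
     H3 \<inter> {y. bisector_normal x (psl_act g x) \<bullet> y = bisector_offset x (psl_act g x)}"
    unfolding halfspace_eq[OF assms(1,2)] frontier_Int_open[OF open_H3]
    using bisector_normal_nonzero[OF assms(1-3)] by (auto simp: frontier_halfspace_le)
  with assms(4) show ?thesis
    by blast
qed


section \<open>Convex sets\<close>

text \<open>
  A violated irredundant constraint cuts out a facet: the segment from the interior point \<open>x\<close>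
  to a point violating only that constraint crosses its hyperplane where all other constraints
  are strict.
\<close>

lemma violated_facet:
  fixes a :: "'i \<Rightarrow> 'a::euclidean_space"
  assumes "finite T" "open U" "convex U" "x \<in> U" "\<And>i. i \<in> T \<Longrightarrow> a i \<bullet> x < b i"
    and "p \<in> U" "\<exists>i\<in>T. b i < a i \<bullet> p"
  shows "\<exists>i\<in>T. b i < a i \<bullet> p \<and>
    aff_dim ((U \<inter> {y. \<forall>j\<in>T. a j \<bullet> y \<le> b j}) \<inter> {y. a i \<bullet> y = b i}) = DIM('a) - 1"
  using assms
proof (induction T rule: finite_psubset_induct)
  case (psubset T)
  let ?D = "\<lambda>T. U \<inter> {y. \<forall>j\<in>T. a j \<bullet> y \<le> b j}"
  show ?case
  proof (cases "\<exists>i\<in>T. ?D (T - {i}) = ?D T")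
    case True
    then obtain i where i: "i \<in> T" and eq: "?D (T - {i}) = ?D T"
      by blast
    have "\<exists>j\<in>T - {i}. b j < a j \<bullet> p"
      using eq psubset.prems(5,6) by (auto simp: set_eq_iff not_le[symmetric])
    then have "\<exists>j\<in>T - {i}. b j < a j \<bullet> p \<and> aff_dim (?D (T - {i}) \<inter> {y. a j \<bullet> y = b j}) = DIM('a) - 1"
      using i psubset.prems by (intro psubset.IH) auto
    then show ?thesis
      unfolding eq by blast
  next
    \<comment> \<open>Without redundancy any constraint violated by \<open>p\<close> will do. Since
      \<open>p\<close> may violate several, a separate point \<open>z\<close> violating only this
      one is chosen.\<close>
    case False
    obtain i where i: "i \<in> T" "b i < a i \<bullet> p"
      using psubset.prems(6) by blast
    have "?D T \<subseteq> ?D (T - {i})"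
      by auto
    with False i obtain z where z: "z \<in> ?D (T - {i})" "z \<notin> ?D T"
      by blast
    then obtain j where "j \<in> T" "b j < a j \<bullet> z"
      by (auto simp: not_le)
    moreover from this z(1) have "j = i"
      by (auto simp: not_le[symmetric])
    ultimately have zi: "b i < a i \<bullet> z"
      by simp
    have zU: "z \<in> U"
      using z by simp
    have xi: "a i \<bullet> x < b i"
      using i psubset.prems by auto
    \<comment> \<open>The parameter at which the segment from \<open>x\<close> to \<open>z\<close>
      meets the hyperplane of \<open>i\<close>.\<close>
    define t where "t = (b i - a i \<bullet> x) / (a i \<bullet> z - a i \<bullet> x)"
    have t: "0 < t" "t < 1"
      using xi zi by (auto simp: t_def)
    define w where "w = (1 - t) *\<^sub>R x + t *\<^sub>R z"
    have wU: "w \<in> U"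
      unfolding w_def using t psubset.prems zU by (intro convexD) auto
    have aw: "a j \<bullet> w = a j \<bullet> x + t * (a j \<bullet> z - a j \<bullet> x)" for j
      by (simp add: w_def inner_add_right algebra_simps)
    have wi: "a i \<bullet> w = b i"
      unfolding aw using xi zi by (simp add: t_def)
    have wj: "a j \<bullet> w < b j" if j: "j \<in> T - {i}" for j
    proof -
      have "(1 - t) * (a j \<bullet> x) < (1 - t) * b j"
        using t psubset.prems j by (intro mult_strict_left_mono) auto
      moreover have "t * (a j \<bullet> z) \<le> t * b j"
        using t z j by (intro mult_left_mono) auto
      ultimately show ?thesis
        unfolding aw by (simp add: algebra_simps)
    qed
    \<comment> \<open>A neighbourhood of \<open>w\<close> on which only constraint \<open>i\<close>
      matters; its slice by the hyperplane has full dimension there.\<close>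
    let ?V = "U \<inter> (\<Inter>j\<in>T - {i}. {y. a j \<bullet> y < b j})"
    have V: "open ?V" "w \<in> ?V"
      using psubset.hyps psubset.prems wU wj by (auto intro!: open_INT simp: open_halfspace_lt)
    have ai: "a i \<noteq> 0"
      using xi zi by auto
    have dim: "aff_dim ({y. a i \<bullet> y = b i} \<inter> ?V) = DIM('a) - 1"
      using V wi by (subst aff_dim_convex_Int_open) (auto simp: ai convex_hyperplane)
    have "{y. a i \<bullet> y = b i} \<inter> ?V \<subseteq> ?D T \<inter> {y. a i \<bullet> y = b i}"
      by (force intro: less_imp_le)
    then have "DIM('a) - 1 \<le> aff_dim (?D T \<inter> {y. a i \<bullet> y = b i})"
      unfolding dim[symmetric] by (rule aff_dim_subset)
    moreover have "aff_dim (?D T \<inter> {y. a i \<bullet> y = b i}) \<le> aff_dim {y. a i \<bullet> y = b i}"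
      by (intro aff_dim_subset) auto
    ultimately have "aff_dim (?D T \<inter> {y. a i \<bullet> y = b i}) = DIM('a) - 1"
      by (simp add: ai)
    with i show ?thesis
      by blast
  qed
qed

text \<open>The hull of \<open>p\<close> and the ball has nonempty interior, and a convex set with
  nonempty interior lies in the closure of that interior; so \<open>U\<close> meets it near
  \<open>p\<close>. The small ball is found before \<open>C\<close> is given, which makes the later
  volume bound uniform.\<close>

lemma convex_contains_ball_near_point:
  fixes p x :: "'a::euclidean_space"
  assumes "0 < \<delta>" "open U" "p \<in> U"
  obtains w \<eta> where "0 < \<eta>" "ball w \<eta> \<subseteq> U"
    "\<And>C. convex C \<Longrightarrow> ball x \<delta> \<subseteq> C \<Longrightarrow> p \<in> C \<Longrightarrow> ball w \<eta> \<subseteq> C"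
proof -
  let ?H = "convex hull (insert p (ball x \<delta>))"
  have sub: "insert p (ball x \<delta>) \<subseteq> ?H"
    by (rule hull_subset)
  then have "ball x \<delta> \<subseteq> interior ?H"
    by (intro interior_maximal) auto
  then have "interior ?H \<noteq> {}"
    using assms(1) by force
  then have "closure (interior ?H) = closure ?H"
    by (intro convex_closure_interior) auto
  then have "p \<in> closure (interior ?H)"
    using sub closure_subset by blast
  then have "U \<inter> interior ?H \<noteq> {}"
    using assms(2,3) by (metis IntI closure_iff_nhds_not_empty inf_commute order_refl)
  then obtain w where w: "w \<in> U \<inter> interior ?H"
    by blast
  moreover have "open (U \<inter> interior ?H)"
    using assms(2) by blast
  ultimately obtain \<eta> where \<eta>: "0 < \<eta>" "ball w \<eta> \<subseteq> U \<inter> interior ?H"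
    by (meson open_contains_ball)
  show ?thesis
  proof (rule that[of \<eta> w])
    fix C :: "'a set"
    assume "convex C" "ball x \<delta> \<subseteq> C" "p \<in> C"
    then have "?H \<subseteq> C"
      by (intro hull_minimal) auto
    with \<eta> show "ball w \<eta> \<subseteq> C"
      using interior_subset by blast
  qed (use \<eta> in auto)
qed

text \<open>The hyperbolic density is at least 1 on \<open>H3\<close>.\<close>

lemma emeasure_hvol_ge:
  assumes "B \<in> sets borel" "B \<subseteq> H3"
  shows "emeasure lborel B \<le> emeasure hvol B"
proof -
  have "(\<lambda>p::real^3. ennreal (indicator H3 p / (1 - p \<bullet> p)\<^sup>2)) \<in> borel_measurable lborel"
    using open_H3 by (measurable; simp)
  then have "emeasure hvol B = (\<integral>\<^sup>+p. ennreal (indicator H3 p / (1 - p \<bullet> p)\<^sup>2) * indicator B p \<partial>lborel)"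
    using assms(1) by (simp add: hvol_def emeasure_density)
  moreover have "emeasure lborel B = (\<integral>\<^sup>+p. indicator B p \<partial>lborel)"
    using assms(1) by simp
  moreover have "indicator B p \<le> ennreal (indicator H3 p / (1 - p \<bullet> p)\<^sup>2) * indicator B p" for p
  proof (cases "p \<in> B")
    case True
    then have p: "p \<in> H3"
      using assms(2) by blast
    then have "0 < 1 - p \<bullet> p" "1 - p \<bullet> p \<le> 1"
      by (auto simp: H3_iff)
    then have "0 < (1 - p \<bullet> p)\<^sup>2" "(1 - p \<bullet> p)\<^sup>2 \<le> 1"
      by (auto simp: power_le_one)
    then have "1 \<le> 1 / (1 - p \<bullet> p)\<^sup>2"
      by simp
    with True p show ?thesis
      by simp
  qed simp
  ultimately show ?thesis
    by (simp add: nn_integral_mono)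
qed


section \<open>Domains and the Cayley graph\<close>

locale hyperbolic_group =
  fixes \<Gamma> :: "(complex^2^2) set set"
  assumes sub: "subgroup \<Gamma> PSL2C"
    and free: "acts_freely \<Gamma>"
    and disc: "acts_properly_discontinuously \<Gamma>"
begin

section \<open>The group action and its orbits\<close>

lemma in_PSL2C: "g \<in> \<Gamma> \<Longrightarrow> g \<in> carrier PSL2C"
  by (rule subgroup.mem_carrier[OF sub])

lemma act_in_H3: "g \<in> \<Gamma> \<Longrightarrow> p \<in> H3 \<Longrightarrow> psl_act g p \<in> H3"
  by (simp add: psl_act_in_H3 in_PSL2C)

lemma act_neq: "g \<in> \<Gamma> - {\<one>\<^bsub>PSL2C\<^esub>} \<Longrightarrow> p \<in> H3 \<Longrightarrow> psl_act g p \<noteq> p"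
  using free by (auto simp: acts_freely_def)

lemma inv_in: "g \<in> \<Gamma> \<Longrightarrow> inv\<^bsub>PSL2C\<^esub> g \<in> \<Gamma>"
  by (rule subgroup.m_inv_closed[OF sub])

lemma inv_in_nontrivial:
  assumes "g \<in> \<Gamma> - {\<one>\<^bsub>PSL2C\<^esub>}"
  shows "inv\<^bsub>PSL2C\<^esub> g \<in> \<Gamma> - {\<one>\<^bsub>PSL2C\<^esub>}"
  using assms inv_in in_PSL2C group.inv_eq_1_iff[OF group_PSL2C] by auto

lemma hdist_act_inv:
  assumes "g \<in> \<Gamma>" "p \<in> H3" "q \<in> H3"
  shows "hdist (psl_act (inv\<^bsub>PSL2C\<^esub> g) p) q = hdist p (psl_act g q)"
proof -
  have g: "g \<in> carrier PSL2C" "inv\<^bsub>PSL2C\<^esub> g \<in> carrier PSL2C"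
    using assms in_PSL2C inv_in by auto
  have "psl_act g (psl_act (inv\<^bsub>PSL2C\<^esub> g) p) = p"
    using g assms by (simp add: psl_act_mult[symmetric] group.r_inv[OF group_PSL2C] psl_act_one)
  then show ?thesis
    using hdist_psl_act[OF g(1) act_in_H3[OF inv_in[OF assms(1)] assms(2)] assms(3)] by simp
qed

lemma finite_orbit_in_hball:
  assumes "x \<in> H3" "R > 0"
  shows "finite {g \<in> \<Gamma>. psl_act g x \<in> hball x R}"
proof -
  obtain K where K: "compact K" "K \<subseteq> H3" "hball x R \<subseteq> K"
    using hball_subset_cball[OF assms(1)] .
  then have "finite {g \<in> \<Gamma>. psl_act g ` K \<inter> K \<noteq> {}}"
    using disc by (simp add: acts_properly_discontinuously_def)
  moreover have "x \<in> K"
    using K assms by (auto simp: hball_def hdist_self)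
  ultimately show ?thesis
    using K(3) by (elim rev_finite_subset) blast
qed

text \<open>Proper discontinuity leaves only finitely many elements moving \<open>x\<close> by at
  most \<open>e\<close>, and freeness keeps each nontrivial one from fixing
  \<open>x\<close>.\<close>

lemma orbit_isolated:
  assumes x: "x \<in> H3"
  obtains r where "0 < r" "\<And>g. g \<in> \<Gamma> - {\<one>\<^bsub>PSL2C\<^esub>} \<Longrightarrow> r \<le> dist (psl_act g x) x"
proof -
  obtain e where e: "0 < e" "cball x e \<subseteq> H3"
    using x open_H3 by (meson open_contains_cball)
  define F where "F = {g \<in> \<Gamma>. psl_act g ` cball x e \<inter> cball x e \<noteq> {}}"
  have "finite F"
    unfolding F_def using disc e by (simp add: acts_properly_discontinuously_def)
  then obtain d where d: "0 < d" "\<forall>z\<in>(\<lambda>g. psl_act g x) ` F. z \<noteq> x \<longrightarrow> d \<le> dist x z"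
    using finite_set_avoid by (metis finite_imageI)
  show ?thesis
  proof (rule that[of "min d e"])
    fix g
    assume g: "g \<in> \<Gamma> - {\<one>\<^bsub>PSL2C\<^esub>}"
    show "min d e \<le> dist (psl_act g x) x"
    proof (cases "dist (psl_act g x) x \<le> e")
      case True
      then have "psl_act g x \<in> psl_act g ` cball x e \<inter> cball x e"
        using e(1) by (auto simp: dist_commute)
      then have "g \<in> F"
        using g unfolding F_def by blast
      then have "d \<le> dist x (psl_act g x)"
        using d act_neq[OF g x] by auto
      then show ?thesis
        by (simp add: dist_commute)
    qed simp
  qed (use d e in auto)
qed

text \<open>Near \<open>x\<close> the value \<open>hcosh x y\<close> is close to 1, while every
  other orbit point has Euclidean distance at least \<open>r / 2\<close> from \<open>y\<close> and
  hence \<open>hcosh\<close> bounded away from 1. One neighbourhood thus serves all group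
  elements.\<close>

lemma dirichlet_domain_contains_ball:
  assumes x: "x \<in> H3"
  obtains \<delta> where "0 < \<delta>" "ball x \<delta> \<subseteq> dirichlet_domain \<Gamma> x"
proof -
  obtain r where r: "0 < r" "\<And>g. g \<in> \<Gamma> - {\<one>\<^bsub>PSL2C\<^esub>} \<Longrightarrow> r \<le> dist (psl_act g x) x"
    using orbit_isolated[OF x] by blast
  have "((\<lambda>y. hcosh x y) \<longlongrightarrow> hcosh x x) (nhds x)"
    unfolding hcosh_def by (intro tendsto_intros filterlim_ident) (use x in \<open>auto simp: H3_iff\<close>)
  then have "((\<lambda>y. (hcosh x y)\<^sup>2) \<longlongrightarrow> 1) (nhds x)"
    using x by (metis hcosh_self one_power2 tendsto_power)
  moreover have "1 < 1 + (r / 2)\<^sup>2"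
    using r(1) by simp
  ultimately have "\<forall>\<^sub>F y in nhds x. (hcosh x y)\<^sup>2 < 1 + (r / 2)\<^sup>2"
    by (rule order_tendstoD)
  moreover have "\<forall>\<^sub>F y in nhds x. dist y x < r / 2"
    unfolding eventually_nhds_metric using r(1) by (intro exI[of _ "r / 2"]) auto
  moreover have "\<forall>\<^sub>F y in nhds x. y \<in> H3"
    using x open_H3 by (auto simp: eventually_nhds)
  ultimately have "\<forall>\<^sub>F y in nhds x. y \<in> dirichlet_domain \<Gamma> x"
  proof eventually_elim
    case (elim y)
    have "hdist x y \<le> hdist (psl_act g x) y" if g: "g \<in> \<Gamma> - {\<one>\<^bsub>PSL2C\<^esub>}" for g
    proof -
      define z where "z = psl_act g x"
      have z: "z \<in> H3"
        using act_in_H3 g x by (simp add: z_def)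
      have "r \<le> dist z x"
        unfolding z_def using r(2)[OF g] .
      moreover have "dist z x \<le> dist z y + dist y x"
        by (rule dist_triangle)
      ultimately have "r / 2 \<le> dist z y"
        using elim by simp
      then have "(r / 2)\<^sup>2 \<le> (dist z y)\<^sup>2"
        using r(1) by (intro power_mono) auto
      then have "(hcosh x y)\<^sup>2 \<le> (hcosh z y)\<^sup>2"
        using elim hcosh_lower_bound[of z y] z by linarith
      then have "hcosh x y \<le> hcosh z y"
        using hcosh_pos[of z y] z elim by (meson power2_le_imp_le less_imp_le)
      then show ?thesis
        unfolding z_def[symmetric] using x z elim by (simp add: hdist_le_iff)
    qed
    with elim show ?case
      by (auto simp: dirichlet_domain_def domain_of_def halfspace_def)
  qed
  then show ?thesis
    using that by (auto simp: eventually_nhds_metric subset_iff dist_commute)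
qed

section \<open>Polyhedral domains: convexity, measurability, facets\<close>

lemma domain_of_eq:
  assumes "x \<in> H3" "S \<subseteq> \<Gamma>"
  shows "domain_of S x = H3 \<inter> {y. \<forall>g\<in>S.
    bisector_normal x (psl_act g x) \<bullet> y \<le> bisector_offset x (psl_act g x)}"
proof -
  have "halfspace x g = H3 \<inter> {y. bisector_normal x (psl_act g x) \<bullet> y \<le> bisector_offset x (psl_act g x)}"
    if "g \<in> S" for g
    using assms that by (intro halfspace_eq act_in_H3) auto
  then show ?thesis
    by (auto simp: domain_of_def)
qed

lemma domain_of_eq_Inter:
  assumes "x \<in> H3" "S \<subseteq> \<Gamma>"
  shows "domain_of S x = H3 \<inter> (\<Inter>g\<in>S.
    {y. bisector_normal x (psl_act g x) \<bullet> y \<le> bisector_offset x (psl_act g x)})"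
  by (auto simp: domain_of_eq[OF assms])

lemma convex_domain_of: "x \<in> H3 \<Longrightarrow> S \<subseteq> \<Gamma> \<Longrightarrow> convex (domain_of S x)"
  by (simp add: domain_of_eq_Inter convex_Int convex_H3 convex_INT convex_halfspace_le)

text \<open>An open set meets an intersection of closed half-spaces; any index set is allowed, so
  the Dirichlet domain is covered.\<close>

lemma borel_domain_of: "x \<in> H3 \<Longrightarrow> S \<subseteq> \<Gamma> \<Longrightarrow> domain_of S x \<in> sets borel"
  unfolding domain_of_eq_Inter
  by (rule sets.Int[OF borel_open[OF open_H3] borel_closed]) (auto intro: closed_halfspace_le)

text \<open>Supplies the Cayley graph generator for one descent step, from
  \<open>violated_facet\<close> with the basepoint strictly inside all half-spaces.\<close>

lemma not_in_domain_of_imp_facet: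
  assumes x: "x \<in> H3" and S: "finite S" "S \<subseteq> \<Gamma> - {\<one>\<^bsub>PSL2C\<^esub>}"
    and p: "p \<in> H3" "p \<notin> domain_of S x"
  obtains s where "s \<in> S" "corresponds_to_face x (domain_of S x) s"
    "hdist (psl_act s x) p < hdist x p"
proof -
  define a b where "a s = bisector_normal x (psl_act s x)"
    and "b s = bisector_offset x (psl_act s x)" for s
  have S': "S \<subseteq> \<Gamma>"
    using S by blast
  have D: "domain_of S x = H3 \<inter> {y. \<forall>j\<in>S. a j \<bullet> y \<le> b j}"
    unfolding a_def b_def by (rule domain_of_eq[OF x S'])
  have act: "psl_act s x \<in> H3" "psl_act s x \<noteq> x" if "s \<in> S" for s
    using that S(2) x act_in_H3 act_neq[of s x] by auto
  have "\<exists>s\<in>S. b s < a s \<bullet> p \<and>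
      aff_dim ((H3 \<inter> {y. \<forall>j\<in>S. a j \<bullet> y \<le> b j}) \<inter> {y. a s \<bullet> y = b s}) = DIM(real^3) - 1"
  proof (rule violated_facet[OF S(1) open_H3 convex_H3 x _ p(1)])
    show "\<exists>i\<in>S. b i < a i \<bullet> p"
      using p unfolding D by (auto simp: not_le)
    fix i
    assume "i \<in> S"
    then have "hcosh x x < hcosh (psl_act i x) x"
      using act x by (simp add: hcosh_self hcosh_gt_one)
    then show "a i \<bullet> x < b i"
      unfolding a_def b_def hcosh_less_iff_bisector[OF x] .
  qed
  then obtain s where s: "s \<in> S" "b s < a s \<bullet> p"
    and dim: "aff_dim (domain_of S x \<inter> {y. a s \<bullet> y = b s}) = 2"
    unfolding D by auto
  have fr: "frontier (halfspace x s) \<inter> domain_of S x = domain_of S x \<inter> {y. a s \<bullet> y = b s}"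
    unfolding a_def b_def using s(1) act x
    by (intro frontier_halfspace_Int) (auto simp: domain_of_def)
  have "(domain_of S x \<inter> {y. a s \<bullet> y = b s}) face_of domain_of S x"
    using s(1) by (intro face_of_Int_supporting_hyperplane_le convex_domain_of[OF x S']) (auto simp: D)
  then have "corresponds_to_face x (domain_of S x) s"
    using dim by (simp add: corresponds_to_face_def fr)
  moreover have "hdist (psl_act s x) p < hdist x p"
    using s(2) hcosh_le_iff_bisector[OF p(1), of x "psl_act s x"] act[OF s(1)] x p(1)
    by (simp add: hdist_less_iff a_def b_def)
  ultimately show ?thesis
    using s(1) that by blast
qed

section \<open>Volume excess and excluded orbit points\<close>

lemma orbit_point_outside_domain_of:
  assumes x: "x \<in> H3" and h: "h \<in> \<Gamma> - {\<one>\<^bsub>PSL2C\<^esub>}"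
  obtains \<epsilon> where "0 < \<epsilon>"
    "\<And>S. S \<subseteq> \<Gamma> - {\<one>\<^bsub>PSL2C\<^esub>} \<Longrightarrow>
      emeasure hvol (domain_of S x) - emeasure hvol (dirichlet_domain \<Gamma> x) < ennreal \<epsilon> \<Longrightarrow>
      psl_act h x \<notin> domain_of S x"
proof -
  let ?D = "dirichlet_domain \<Gamma> x" and ?U = "H3 - halfspace x h"
  obtain \<delta> where \<delta>: "0 < \<delta>" "ball x \<delta> \<subseteq> ?D"
    using dirichlet_domain_contains_ball[OF x] .
  have hx: "psl_act h x \<in> H3" "psl_act h x \<noteq> x"
    using h x act_in_H3 act_neq by auto
  have "?U = H3 \<inter> {y. bisector_normal x (psl_act h x) \<bullet> y > bisector_offset x (psl_act h x)}"
    unfolding halfspace_eq[OF x hx(1)] by auto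
  then have "open ?U"
    by (simp add: open_Int open_H3 open_halfspace_gt)
  moreover have "psl_act h x \<in> ?U"
    using hx x hcosh_gt_one[OF x hx(1)] by (simp add: halfspace_def hdist_le_iff hcosh_self)
  ultimately obtain w \<eta> where \<eta>: "0 < \<eta>" "ball w \<eta> \<subseteq> ?U"
    and sub: "\<And>C. convex C \<Longrightarrow> ball x \<delta> \<subseteq> C \<Longrightarrow> psl_act h x \<in> C \<Longrightarrow> ball w \<eta> \<subseteq> C"
    using convex_contains_ball_near_point[OF \<delta>(1)] by metis
  \<comment> \<open>The Lebesgue content of the small ball serves as the real bound: it is positive,
    finite and at most the hyperbolic volume.\<close>
  have ball: "ennreal (measure lborel (ball w \<eta>)) \<le> emeasure hvol (ball w \<eta>)"
    using emeasure_hvol_ge[of "ball w \<eta>"] \<eta>(2) emeasure_lborel_ball_finite[of w \<eta>]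
    by (auto simp: emeasure_eq_ennreal_measure)
  show ?thesis
  proof (rule that[of "measure lborel (ball w \<eta>)"])
    show "0 < measure lborel (ball w \<eta>)"
      by (rule content_ball_pos[OF \<eta>(1)])
    fix S
    assume S: "S \<subseteq> \<Gamma> - {\<one>\<^bsub>PSL2C\<^esub>}"
      and vol: "emeasure hvol (domain_of S x) - emeasure hvol ?D < ennreal (measure lborel (ball w \<eta>))"
    then have S': "S \<subseteq> \<Gamma>"
      by blast
    show "psl_act h x \<notin> domain_of S x"
    proof
      assume "psl_act h x \<in> domain_of S x"
      moreover have DS: "?D \<subseteq> domain_of S x"
        using S by (auto simp: dirichlet_domain_def domain_of_def)
      ultimately have B: "ball w \<eta> \<subseteq> domain_of S x"
        using \<delta> by (intro sub convex_domain_of[OF x S']) auto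
      have disj: "?D \<inter> ball w \<eta> = {}"
        using \<eta>(2) h by (auto simp: dirichlet_domain_def domain_of_def)
      have meas: "?D \<in> sets hvol" "ball w \<eta> \<in> sets hvol" "domain_of S x \<in> sets hvol"
        using borel_domain_of[OF x] S' by (auto simp: hvol_def dirichlet_domain_def)
      have "emeasure hvol ?D + emeasure hvol (ball w \<eta>) = emeasure hvol (?D \<union> ball w \<eta>)"
        using meas disj by (intro plus_emeasure)
      also have "\<dots> \<le> emeasure hvol (domain_of S x)"
        using B DS meas by (intro emeasure_mono) auto
      finally have le: "emeasure hvol ?D + emeasure hvol (ball w \<eta>) \<le> emeasure hvol (domain_of S x)" .
      have "emeasure hvol (ball w \<eta>) \<le> emeasure hvol (domain_of S x) - emeasure hvol ?D"
      proof (cases "emeasure hvol ?D = \<infinity>")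
        \<comment> \<open>Then \<open>domain_of S x\<close> has infinite volume too, and in
          \<open>ennreal\<close> infinity minus infinity is infinity.\<close>
        case True
        then show ?thesis
          using le by (simp add: top_unique)
      next
        case False
        then show ?thesis
          using ennreal_minus_mono[OF le, of "emeasure hvol ?D" "emeasure hvol ?D"] by simp
      qed
      with ball vol show False
        by (meson leD order_trans)
    qed
  qed
qed

text \<open>The minimum of finitely many positive bounds is positive.\<close>

lemma uniform_volume_gap:
  assumes x: "x \<in> H3" and F: "finite F" "F \<subseteq> \<Gamma> - {\<one>\<^bsub>PSL2C\<^esub>}"
  shows "\<exists>\<epsilon>>0. \<forall>S \<subseteq> \<Gamma> - {\<one>\<^bsub>PSL2C\<^esub>}.
    emeasure hvol (domain_of S x) - emeasure hvol (dirichlet_domain \<Gamma> x) < ennreal \<epsilon> \<longrightarrow>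
    (\<forall>h\<in>F. psl_act h x \<notin> domain_of S x)"
  using F
proof (induction F rule: finite_induct)
  case empty
  then show ?case
    by (auto intro: exI[of _ 1])
next
  case (insert h F)
  let ?V = "\<lambda>S. emeasure hvol (domain_of S x) - emeasure hvol (dirichlet_domain \<Gamma> x)"
  obtain e where e: "0 < e" "\<forall>S \<subseteq> \<Gamma> - {\<one>\<^bsub>PSL2C\<^esub>}. ?V S < ennreal e \<longrightarrow>
      (\<forall>h\<in>F. psl_act h x \<notin> domain_of S x)"
    using insert by auto
  obtain e' where e': "0 < e'" "\<And>S. S \<subseteq> \<Gamma> - {\<one>\<^bsub>PSL2C\<^esub>} \<Longrightarrow> ?V S < ennreal e' \<Longrightarrow>
      psl_act h x \<notin> domain_of S x"
    using orbit_point_outside_domain_of[OF x, of h] insert.prems by auto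
  show ?case
  proof (intro exI[of _ "min e e'"] conjI allI impI)
    show "0 < min e e'"
      using e e' by simp
    fix S
    assume S: "S \<subseteq> \<Gamma> - {\<one>\<^bsub>PSL2C\<^esub>}" and "?V S < ennreal (min e e')"
    then have "?V S < ennreal e" "?V S < ennreal e'"
      using e(1) e'(1) by (auto elim!: order_less_le_trans intro!: ennreal_leI)
    then show "\<forall>h\<in>insert h F. psl_act h x \<notin> domain_of S x"
      using e e' S by auto
  qed
qed

section \<open>Descent in the Cayley graph\<close>

lemma connected_inside_ball_if_orbit_outside:
  assumes x: "x \<in> H3" and R: "R > 0" and S: "finite S" "S \<subseteq> \<Gamma> - {\<one>\<^bsub>PSL2C\<^esub>}"
    and out: "\<And>h. h \<in> \<Gamma> - {\<one>\<^bsub>PSL2C\<^esub>} \<Longrightarrow> psl_act h x \<in> hball x R \<Longrightarrow> psl_act h x \<notin> domain_of S x"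
  shows "connected_inside_ball \<Gamma> x (domain_of S x) R"
proof -
  define V where "V = {g \<in> \<Gamma>. psl_act g x \<in> hball x R}"
  define G where "G = with_proj (cayley_graph \<Gamma> x (domain_of S x)) \<restriction> V"
  let ?E = "(arcs_ends G)\<^sup>s" and ?d = "\<lambda>g. hdist x (psl_act g x)"
  have V: "g \<in> V \<longleftrightarrow> g \<in> \<Gamma> \<and> ?d g < R" for g
    using act_in_H3[OF _ x] by (auto simp: V_def hball_def)
  have one: "\<one>\<^bsub>PSL2C\<^esub> \<in> V"
    using subgroup.one_closed[OF sub] R x by (simp add: V psl_act_one hdist_self)
  have finV: "finite V"
    unfolding V_def by (rule finite_orbit_in_hball[OF x R])
  have step: "\<exists>k\<in>V. ?d k < ?d g \<and> (g, k) \<in> ?E" if g: "g \<in> V" "g \<noteq> \<one>\<^bsub>PSL2C\<^esub>" for g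
  proof -
    \<comment> \<open>Translating by the inverse of \<open>g\<close> moves the vertex
      \<open>gx\<close> to the basepoint and the target \<open>x\<close> to
      \<open>p\<close>.\<close>
    define p where "p = psl_act (inv\<^bsub>PSL2C\<^esub> g) x"
    have g\<Gamma>: "g \<in> \<Gamma> - {\<one>\<^bsub>PSL2C\<^esub>}"
      using g V by blast
    have p: "p \<in> H3"
      using g\<Gamma> x act_in_H3 inv_in by (simp add: p_def)
    have dp: "hdist x p = ?d g"
      using g\<Gamma> x hdist_act_inv[of g x x] by (simp add: p_def hdist_commute)
    have "p \<in> hball x R"
      using p g by (simp add: hball_def dp V)
    then have "p \<notin> domain_of S x"
      unfolding p_def using g\<Gamma> by (intro out inv_in_nontrivial)
    then obtain s where s: "s \<in> S" "corresponds_to_face x (domain_of S x) s"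
      "hdist (psl_act s x) p < hdist x p"
      using not_in_domain_of_imp_facet[OF x S p] by blast
    have s\<Gamma>: "s \<in> \<Gamma> - {\<one>\<^bsub>PSL2C\<^esub>}"
      using s S by blast
    define k where "k = g \<otimes>\<^bsub>PSL2C\<^esub> s"
    have "?d k = hdist x (psl_act g (psl_act s x))"
      using g\<Gamma> s\<Gamma> in_PSL2C x by (simp add: k_def psl_act_mult)
    also have "\<dots> = hdist p (psl_act s x)"
      unfolding p_def using g\<Gamma> s\<Gamma> act_in_H3 x by (simp add: hdist_act_inv)
    also have "\<dots> < ?d g"
      using s(3) by (simp add: hdist_commute[of p] dp)
    finally have less: "?d k < ?d g" .
    \<comment> \<open>The distance only decreases, so the path never leaves the ball.\<close>
    have kV: "k \<in> V"
      using less g g\<Gamma> s\<Gamma> subgroup.m_closed[OF sub] by (auto simp: V k_def)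
    have "(g, k) \<in> parcs (cayley_graph \<Gamma> x (domain_of S x))"
      using g\<Gamma> s\<Gamma> s(2) by (auto simp: cayley_graph_def k_def)
    then have "(g, k) \<in> arcs_ends G"
      using g kV by (auto simp: G_def induce_subgraph_def arcs_ends_conv intro!: image_eqI[of _ _ "(g, k)"])
    then have "(g, k) \<in> ?E"
      by (simp add: symcl_def)
    with less kV show ?thesis
      by blast
  qed
  have to_one: "(g, \<one>\<^bsub>PSL2C\<^esub>) \<in> rtrancl_on V ?E" if "g \<in> V" for g
    using that
  \<comment> \<open>Distances are real, so the induction counts the vertices closer to
    \<open>x\<close>; \<open>V\<close> is finite.\<close>
  proof (induction "card {k \<in> V. ?d k < ?d g}" arbitrary: g rule: less_induct)
    case less
    show ?case
    proof (cases "g = \<one>\<^bsub>PSL2C\<^esub>")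
      case True
      then show ?thesis
        using less.prems by simp
    next
      case False
      then obtain k where k: "k \<in> V" "?d k < ?d g" "(g, k) \<in> ?E"
        using step less.prems by blast
      then have "{j \<in> V. ?d j < ?d k} \<subset> {j \<in> V. ?d j < ?d g}"
        by (auto simp: psubset_eq)
      then have "card {j \<in> V. ?d j < ?d k} < card {j \<in> V. ?d j < ?d g}"
        using finV by (intro psubset_card_mono) auto
      then have "(k, \<one>\<^bsub>PSL2C\<^esub>) \<in> rtrancl_on V ?E"
        using less.hyps k(1) by blast
      then show ?thesis
        using k less.prems by (blast intro: converse_rtrancl_on_into_rtrancl_on)
    qed
  qed
  \<comment> \<open>Any two vertices are joined through the identity, with the second path
    reversed.\<close>
  have "sym (rtrancl_on V ?E)"
    by (intro rtrancl_on_sym) (auto simp: symcl_def sym_def)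
  then have "(u, v) \<in> rtrancl_on V ?E" if "u \<in> V" "v \<in> V" for u v
    using to_one[OF that(1)] to_one[OF that(2)] by (meson rtrancl_on_trans symD)
  then have "Digraph_Component.connected G"
    using one unfolding connected_conv by (auto simp: G_def)
  then show ?thesis
    by (simp add: connected_inside_ball_def G_def V_def)
qed

end

theorem mainTheorem2:
  fixes \<Gamma> A :: "(complex^2^2) set set" and x :: "real^3" and R :: real
  assumes "finite_volume_hyperbolic_3_manifold \<Gamma>"
    and "finite A" and "A \<subseteq> \<Gamma>" and "generate PSL2C A = \<Gamma>"
    and "x \<in> H3" and "R > 0"
  shows "\<exists>\<epsilon>>0. \<forall>S. approx_dirichlet_domain \<Gamma> A x S \<longrightarrow>
           emeasure hvol (domain_of S x) - emeasure hvol (dirichlet_domain \<Gamma> x) < ennreal \<epsilon> \<longrightarrow>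
           minimizes_spine_radius S x \<longrightarrow>
           connected_inside_ball \<Gamma> x (domain_of S x) R"
proof -
  interpret hyperbolic_group \<Gamma>
    using assms(1) by (intro hyperbolic_group.intro) (auto simp: finite_volume_hyperbolic_3_manifold_def)
  \<comment> \<open>The orbit points to be excluded. The identity is removed because
    \<open>x\<close> itself lies in every domain.\<close>
  define F where "F = {g \<in> \<Gamma>. psl_act g x \<in> hball x R} - {\<one>\<^bsub>PSL2C\<^esub>}"
  have "finite F"
    unfolding F_def using finite_orbit_in_hball[OF assms(5,6)] by blast
  then obtain \<epsilon> where \<epsilon>: "0 < \<epsilon>" and out: "\<forall>S \<subseteq> \<Gamma> - {\<one>\<^bsub>PSL2C\<^esub>}.
      emeasure hvol (domain_of S x) - emeasure hvol (dirichlet_domain \<Gamma> x) < ennreal \<epsilon> \<longrightarrow>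
      (\<forall>h\<in>F. psl_act h x \<notin> domain_of S x)"
    using uniform_volume_gap[OF assms(5), of F] by (auto simp: F_def)
  show ?thesis
  proof (intro exI[of _ \<epsilon>] conjI allI impI)
    fix S
    assume "approx_dirichlet_domain \<Gamma> A x S"
      and vol: "emeasure hvol (domain_of S x) - emeasure hvol (dirichlet_domain \<Gamma> x) < ennreal \<epsilon>"
    then have S: "finite S" "S \<subseteq> \<Gamma> - {\<one>\<^bsub>PSL2C\<^esub>}"
      by (auto simp: approx_dirichlet_domain_def)
    show "connected_inside_ball \<Gamma> x (domain_of S x) R"
      using out S(2) vol
      by (intro connected_inside_ball_if_orbit_outside[OF assms(5,6) S]) (auto simp: F_def)
  qed (rule \<epsilon>)
qed

end
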